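(* Let $X_1,X_2,\dots$ be i.i.d. real-valued continuous random variables. Let $0<p<1$, $n\ge1$, $X_1\in L^{\max\{p,1-p\}}$ and $\alpha\in\overline{\mathbb{H}}$. Then $$n^{1/p}M^{f^{(\alpha)}_p}_n-n M^{f^{(\alpha)}_1}_n\in L^1,$$ where $M^{f^{(\alpha)}_p}_n=\left(\frac1n\sum_{j=1}^n (X_j+\alpha)^p\right)^{1/p}-\alpha$ and $M^{f^{(\alpha)}_1}_n=\frac1n\sum_{j=1}^n X_j$.
   Context: $\overline{\mathbb{H}}=\{z\in\mathbb{C}:\mathrm{Im}(z)\ge0\}$. Complex powers use the principal branch: $z^q=\exp(q\log z)$ with $\log z=\log r+i\theta$ for $z=r e^{i\theta}$, $r>0$, $\theta\in(-\pi,\pi]$; $0^p=0$ for $0<p<1$. Here $f^{(\alpha)}_p(x)=(x+\alpha)^p$ and $M^f_n=f^{-1}(\frac1n\sum_{j=1}^n f(X_j))$. A complex-valued random variable $Y$ is in $L^s$ ($s>0$) if $E[|Y|^s]<+\infty$. "Continuous" random variable means that its distribution function is continuous, i.e. $P(X_1=x)=0$ for every $x\in\mathbb{R}$. *)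

theory Defs
  imports "HOL-Probability.Probability"
begin

(* HOL's complex "powr" is exp (q * Ln z) with Im (Ln z) in (-pi, pi], and 0 powr q = 0;
   this is the principal-branch power, with 0^p = 0. *)

definition shifted_power :: "complex \<Rightarrow> real \<Rightarrow> complex \<Rightarrow> complex" where
  "shifted_power \<alpha> p z = (z + \<alpha>) powr complex_of_real p"

definition shifted_power_inv :: "complex \<Rightarrow> real \<Rightarrow> complex \<Rightarrow> complex" where
  "shifted_power_inv \<alpha> p w = w powr complex_of_real (1 / p) - \<alpha>"

definition shifted_power_mean :: "complex \<Rightarrow> real \<Rightarrow> nat \<Rightarrow> (nat \<Rightarrow> real) \<Rightarrow> complex" where
  "shifted_power_mean \<alpha> p n x =
     shifted_power_inv \<alpha> p
       (1 / of_nat n * (\<Sum>j=1..n. shifted_power \<alpha> p (complex_of_real (x j))))"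

definition (in prob_space) in_L :: "real \<Rightarrow> ('a \<Rightarrow> 'b::real_normed_vector) \<Rightarrow> bool" where
  "in_L s Y \<longleftrightarrow>
     Y \<in> borel_measurable M \<and> (\<integral>\<^sup>+ \<omega>. ennreal (norm (Y \<omega>) powr s) \<partial>M) < \<infinity>"

definition (in prob_space) iid_from_1 :: "(nat \<Rightarrow> 'a \<Rightarrow> real) \<Rightarrow> bool" where
  "iid_from_1 X \<longleftrightarrow>
     indep_vars (\<lambda>_. borel) X {1..} \<and>
     (\<forall>j\<ge>1. distr M borel (X j) = distr M borel (X 1))"

(* "Continuous" refers to the distribution function; a density is not required. *)
definition (in prob_space) continuous_rv :: "('a \<Rightarrow> real) \<Rightarrow> bool" where
  "continuous_rv Y \<longleftrightarrow>
     random_variable borel Y \<and> continuous_on UNIV (cdf (distr M borel Y))"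

lemma (in prob_space) continuous_rv_iff:
  "continuous_rv Y \<longleftrightarrow>
     random_variable borel Y \<and> (\<forall>x. prob {\<omega> \<in> space M. Y \<omega> = x} = 0)"
proof (cases "random_variable borel Y")
  case True
  interpret D: real_distribution "distr M borel Y"
    using True by (rule real_distribution_distr)
  have "measure (distr M borel Y) {x} = prob {\<omega> \<in> space M. Y \<omega> = x}" for x
    using True by (subst measure_distr) (auto intro!: arg_cong[where f = prob])
  then show ?thesis
    using True by (simp add: continuous_rv_def continuous_on_eq_continuous_at D.isCont_cdf)
qed (simp add: continuous_rv_def)

lemma shifted_power_inv_left:
  assumes "0 < p" "p \<le> 1" "0 \<le> Im (z + \<alpha>)"
  shows "shifted_power_inv \<alpha> p (shifted_power \<alpha> p z) = z"
proof (cases "z + \<alpha> = 0")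
  case True
  then show ?thesis
    by (simp add: shifted_power_inv_def shifted_power_def add_eq_0_iff)
next
  case False
  have b: "0 \<le> Im (Ln (z + \<alpha>))" "Im (Ln (z + \<alpha>)) \<le> pi"
    using assms(3) False Im_Ln_le_pi Im_Ln_pos_le by blast+
  have "p * Im (Ln (z + \<alpha>)) \<le> 1 * pi"
    using assms b by (intro mult_mono) auto
  moreover have "0 \<le> p * Im (Ln (z + \<alpha>))"
    using assms b by simp
  ultimately have "Ln (exp (complex_of_real p * Ln (z + \<alpha>))) = complex_of_real p * Ln (z + \<alpha>)"
    using pi_gt_zero by (intro Ln_exp) (simp_all del: pi_gt_zero)
  then show ?thesis
    using False assms(1) by (simp add: shifted_power_inv_def shifted_power_def powr_def)
qed

(* The average of the f(x_j) lies in the sector 0 <= arg <= p * pi, so the mean is a point of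
   the domain on which f is injective, and f maps it to the average. *)
lemma shifted_power_mean_correct:
  assumes p: "0 < p" "p \<le> 1" and \<alpha>: "0 \<le> Im \<alpha>"
  shows "shifted_power \<alpha> p (shifted_power_mean \<alpha> p n x) =
           1 / of_nat n * (\<Sum>j=1..n. shifted_power \<alpha> p (complex_of_real (x j)))"
    and "0 \<le> Im (shifted_power_mean \<alpha> p n x + \<alpha>)"
proof -
  define c where "c = cis (- p * pi)"
  have polar: "z = of_real (norm z) * cis (Im (Ln z))" if "z \<noteq> 0" for z
    using that by (metis Arg_eq_Im_Ln rcis_cmod_Arg rcis_def)
  define A where "A = 1 / of_nat n * (\<Sum>j=1..n. shifted_power \<alpha> p (complex_of_real (x j)))"
  have sector: "0 \<le> Im (shifted_power \<alpha> p (complex_of_real t)) \<and>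
      Im (shifted_power \<alpha> p (complex_of_real t) * c) \<le> 0" for t
  proof (cases "complex_of_real t + \<alpha> = 0")
    case False
    define L where "L = Ln (complex_of_real t + \<alpha>)"
    have L: "0 \<le> Im L" "Im L \<le> pi"
      unfolding L_def using \<alpha> False Im_Ln_le_pi Im_Ln_pos_le by (auto simp: Im_Ln_pos_le)
    have m: "0 \<le> p * Im L" "p * Im L \<le> p * pi" "p * pi \<le> pi"
      using L p by (auto intro: mult_left_mono mult_left_le_one_le)
    have e: "shifted_power \<alpha> p (complex_of_real t) = of_real (exp (p * Re L)) * cis (p * Im L)"
      using False by (simp add: shifted_power_def powr_def L_def exp_eq_polar)
    have "sin (p * Im L) \<ge> 0"
      using m by (intro sin_ge_zero) linarith+
    moreover have "sin (p * pi - p * Im L) \<ge> 0"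
      using m by (intro sin_ge_zero) linarith+
    then have "sin (p * Im L - p * pi) \<le> 0"
      using sin_minus[of "p * pi - p * Im L"] by simp
    ultimately show ?thesis
      unfolding e c_def by (simp add: mult.assoc cis_mult mult_nonneg_nonpos)
  qed (simp add: shifted_power_def)
  have A1: "0 \<le> Im A"
  proof -
    have "Im A = 1 / real n * (\<Sum>j=1..n. Im (shifted_power \<alpha> p (complex_of_real (x j))))"
      unfolding A_def by simp
    then show ?thesis using sector by (simp add: sum_nonneg)
  qed
  have A2: "Im (A * c) \<le> 0"
  proof -
    have "Im (A * c) =
        1 / real n * (\<Sum>j=1..n. Im (shifted_power \<alpha> p (complex_of_real (x j)) * c))"
    proof -
      have "A * c = of_real (1 / real n) *
          (\<Sum>j=1..n. shifted_power \<alpha> p (complex_of_real (x j)) * c)"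
        unfolding A_def by (simp add: sum_distrib_right sum_distrib_left)
      then show ?thesis by (simp only: Im_sum[symmetric]) simp
    qed
    then show ?thesis
      using sector by (simp add: sum_nonpos divide_nonpos_nonneg)
  qed
  have arg: "0 \<le> Im (Ln A) \<and> Im (Ln A) \<le> p * pi" if "A \<noteq> 0"
  proof -
    have 0: "0 \<le> Im (Ln A)" "Im (Ln A) \<le> pi"
      using that A1 Im_Ln_le_pi Im_Ln_pos_le by auto
    have "A * c = of_real (norm A) * cis (Im (Ln A) - p * pi)"
      using polar[OF that] by (metis c_def cis_mult mult.assoc mult_minus_left uminus_add_conv_diff add.commute)
    then have "norm A * sin (Im (Ln A) - p * pi) \<le> 0"
      using A2 by simp
    then have s: "sin (Im (Ln A) - p * pi) \<le> 0"
      using that by (simp add: mult_le_0_iff)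
    have "p * pi > 0" using p by simp
    then have "\<not> Im (Ln A) - p * pi > 0"
      using s 0 sin_gt_zero[of "Im (Ln A) - p * pi"] by linarith
    then show ?thesis using 0 by simp
  qed
  have M: "shifted_power_mean \<alpha> p n x + \<alpha> = A powr complex_of_real (1 / p)"
    by (simp add: shifted_power_mean_def shifted_power_inv_def A_def)
  have Im: "0 \<le> Im (Ln A) / p" "Im (Ln A) / p \<le> pi" if "A \<noteq> 0"
    using arg[OF that] p by (simp_all add: divide_le_eq mult.commute)
  show "0 \<le> Im (shifted_power_mean \<alpha> p n x + \<alpha>)"
    unfolding M using Im by (auto simp: powr_def Im_exp intro!: mult_nonneg_nonneg sin_ge_zero)
  show "shifted_power \<alpha> p (shifted_power_mean \<alpha> p n x) =
      1 / of_nat n * (\<Sum>j=1..n. shifted_power \<alpha> p (complex_of_real (x j)))"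
  proof (cases "A = 0")
    case False
    have "Ln (exp (complex_of_real (1 / p) * Ln A)) = complex_of_real (1 / p) * Ln A"
    proof (rule Ln_exp)
      show "- pi < Im (complex_of_real (1 / p) * Ln A)"
        using Im(1)[OF False] pi_gt_zero by (simp del: pi_gt_zero)
      show "Im (complex_of_real (1 / p) * Ln A) \<le> pi"
        using Im(2)[OF False] by simp
    qed
    then have "(A powr complex_of_real (1 / p)) powr complex_of_real p = A"
      using False p by (simp add: powr_def)
    then show ?thesis
      unfolding shifted_power_def[of _ _ "shifted_power_mean \<alpha> p n x"] M A_def[symmetric] .
  next
    case True
    then show ?thesis
      unfolding shifted_power_def[of _ _ "shifted_power_mean \<alpha> p n x"] M A_def[symmetric] by simp
  qed
qed

lemma shifted_power_mean_1:
  assumes "1 \<le> n"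
  shows "shifted_power_mean \<alpha> 1 n x = complex_of_real (1 / real n * (\<Sum>j=1..n. x j))"
  using assms
  by (simp add: shifted_power_mean_def shifted_power_inv_def shifted_power_def sum.distrib
      add_divide_distrib)

end

theory Submission
  imports Defs "HOL-Complex_Analysis.Cauchy_Integral_Theorem"
begin

text \<open>
  Let \<open>z_j = X_j + \<alpha>\<close> and let \<open>S\<close> be the sum of the powers \<open>z_j^p\<close>. Homogeneity of the power
  \<open>1 / p\<close> under positive scaling turns the random variable into a constant plus the defect
  \<open>S^(1/p) - (z_1 + ... + z_n)\<close>. The defect vanishes when at most one \<open>z_j\<close> is nonzero, and it
  stays small when one of them dominates: if \<open>z_k\<close> has the largest modulus, then \<open>S\<close> is a
  perturbation of \<open>z_k^p\<close> by the other powers, and \<open>(z_k^p)^(1/p) = z_k\<close>. These powers and \<open>S\<close> lie in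
  the closed upper half-plane, on bounded parts of which the power \<open>1 / p\<close> is Lipschitz, as its
  exponent exceeds \<open>1\<close> (\<open>norm_powr_diff_le_upper\<close>). The outcome is a pointwise bound of the defect
  by a constant times the sum of the mixed terms \<open>|z_i|^(1-p) |z_j|^p\<close> with \<open>i \<noteq> j\<close>
  (\<open>norm_power_mean_defect_le\<close>).

  In a mixed term the two factors are independent, so its expectation is the product of the
  expectations of \<open>|z_i|^(1-p)\<close> and \<open>|z_j|^p\<close> (\<open>indep_vars_mixed_moment_finite\<close>), both finite by
  the moment assumption.
\<close>

section \<open>Powers on the closed upper half-plane\<close>

text \<open>
  Since \<open>q > 1\<close>, the origin, where the logarithm is singular, is harmless: the derivative
  extends to it by \<open>0\<close>.
\<close>

lemma has_field_derivative_powr_right_half_plane: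
  fixes z :: complex and q :: real
  assumes "1 < q" "0 \<le> Re z"
  shows "((\<lambda>z. z powr of_real q) has_field_derivative (of_real q * z powr (of_real q - 1)))
           (at z within S)"
proof (cases "z = 0")
  case False
  then have "z \<notin> \<real>\<^sub>\<le>\<^sub>0"
    using assms(2) by (auto simp: complex_nonpos_Reals_iff complex_eq_iff)
  then show ?thesis
    by (rule has_field_derivative_at_within[OF has_field_derivative_powr])
next
  case True
  have "((\<lambda>y::complex. y powr (of_real q - 1)) \<longlongrightarrow> 0) (at 0 within S)"
    by (rule tendsto_powr_complex_0[OF tendsto_ident_at tendsto_const]) (use assms(1) in simp)
  moreover have "\<forall>\<^sub>F y in at (0::complex) within S.
      y powr (of_real q - 1) = (y powr of_real q - 0 powr of_real q) / (y - 0)"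
    by (simp add: eventually_at_filter powr_diff)
  ultimately have "((\<lambda>y::complex. (y powr of_real q - 0 powr of_real q) / (y - 0)) \<longlongrightarrow> 0) (at 0 within S)"
    by (rule Lim_transform_eventually)
  then show ?thesis
    unfolding True has_field_derivative_iff by simp
qed

lemma norm_powr_diff_le_right:
  fixes x y :: complex and q R :: real
  assumes q: "1 < q" and "0 \<le> Re x" "0 \<le> Re y" "norm x \<le> R" "norm y \<le> R"
  shows "norm (x powr of_real q - y powr of_real q) \<le> q * R powr (q - 1) * norm (x - y)"
proof (rule field_differentiable_bound)
  let ?S = "{z::complex. 0 \<le> Re z} \<inter> cball 0 R"
  show "convex ?S"
    by (intro convex_Int convex_halfspace_Re_ge convex_cball)
  show "((\<lambda>z. z powr of_real q) has_field_derivative (of_real q * z powr (of_real q - 1)))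
           (at z within ?S)" if "z \<in> ?S" for z
    using that q by (intro has_field_derivative_powr_right_half_plane) auto
  show "norm (of_real q * z powr (of_real q - 1)) \<le> q * R powr (q - 1)" if "z \<in> ?S" for z :: complex
  proof -
    have "norm (z powr of_real (q - 1)) = norm z powr (q - 1)"
      by (subst norm_powr_real_powr') auto
    also have "\<dots> \<le> R powr (q - 1)"
      using that q by (intro powr_mono2) auto
    finally show ?thesis
      using q by (simp add: norm_mult)
  qed
qed (use assms in auto)

text \<open>
  The branch cut of the power is the boundary half-line of negative numbers. Rotating by a right
  angle moves the upper half-plane to the right half-plane, away from the cut, and changes the power
  by a constant factor of modulus \<open>1\<close>.
\<close>

lemma powr_upper_half_plane:
  fixes s :: complex and q :: real
  assumes "0 \<le> Im s"
  shows "s powr of_real q = cis (q * pi / 2) * (- \<i> * s) powr of_real q"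
proof (cases "s = 0")
  case False
  have "Ln s = Ln (- \<i> * s) + \<i> * of_real pi / 2"
    using Ln_times_ii[of "- \<i> * s"] False assms by simp
  then show ?thesis
    using False by (simp add: powr_def cis_conv_exp exp_add[symmetric] algebra_simps)
qed simp

lemma norm_powr_diff_le_upper:
  fixes x y :: complex and q R :: real
  assumes "1 < q" "0 \<le> Im x" "0 \<le> Im y" "norm x \<le> R" "norm y \<le> R"
  shows "norm (x powr of_real q - y powr of_real q) \<le> q * R powr (q - 1) * norm (x - y)"
proof -
  have "x powr of_real q - y powr of_real q =
      cis (q * pi / 2) * ((- \<i> * x) powr of_real q - (- \<i> * y) powr of_real q)"
    using powr_upper_half_plane[OF assms(2), of q] powr_upper_half_plane[OF assms(3), of q]
    by (simp only: right_diff_distrib)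
  then have "norm (x powr of_real q - y powr of_real q) =
      norm ((- \<i> * x) powr of_real q - (- \<i> * y) powr of_real q)"
    by (simp only: norm_mult norm_cis mult_1)
  also have "\<dots> \<le> q * R powr (q - 1) * norm (- \<i> * x - - \<i> * y)"
    using assms by (intro norm_powr_diff_le_right) (auto simp: norm_mult)
  also have "norm (- \<i> * x - - \<i> * y) = norm (x - y)"
    by (simp only: right_diff_distrib[symmetric] norm_mult) simp
  finally show ?thesis .
qed

lemma Im_powr_nonneg:
  fixes z :: complex and p :: real
  assumes "0 \<le> p" "p \<le> 1" "0 \<le> Im z"
  shows "0 \<le> Im (z powr of_real p)"
proof (cases "z = 0")
  case False
  have "0 \<le> Im (Ln z)" "Im (Ln z) \<le> pi"
    using assms False Im_Ln_le_pi Im_Ln_pos_le by auto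
  then have "0 \<le> p * Im (Ln z)" "p * Im (Ln z) \<le> pi"
    using assms mult_mono[of p 1 "Im (Ln z)" pi] by auto
  then show ?thesis
    using False by (simp add: powr_def Im_exp sin_ge_zero)
qed simp

lemma powr_powr_inverse_upper:
  fixes z :: complex and p :: real
  assumes "0 < p" "p \<le> 1" "0 \<le> Im z"
  shows "(z powr of_real p) powr of_real (1 / p) = z"
  using shifted_power_inv_left[of p z 0] assms
  by (simp add: shifted_power_inv_def shifted_power_def)

section \<open>The pointwise bound\<close>

text \<open>
  All pairs \<open>(i, j)\<close> enter on the right because the index \<open>k\<close> of the largest modulus depends on
  the point; only the pairs \<open>(k, j)\<close> are used.
\<close>

lemma norm_power_mean_defect_le:
  fixes z :: "'i \<Rightarrow> complex" and p :: real
  assumes A: "finite A" and p: "0 < p" "p < 1" and z: "\<And>i. i \<in> A \<Longrightarrow> 0 \<le> Im (z i)"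
  shows "norm ((\<Sum>i\<in>A. z i powr of_real p) powr of_real (1 / p) - (\<Sum>i\<in>A. z i))
    \<le> (1 / p * real (card A) powr (1 / p - 1) + 1) *
        (\<Sum>i\<in>A. \<Sum>j\<in>A - {i}. norm (z i) powr (1 - p) * norm (z j) powr p)"
proof (cases "A = {}")
  case False
  define S where "S = (\<Sum>i\<in>A. z i powr of_real p)"
  define C where "C = 1 / p * real (card A) powr (1 / p - 1)"
  let ?N = "(\<lambda>i. norm (z i)) ` A"
  have "Max ?N \<in> ?N"
    using A False by (intro Max_in) auto
  then obtain k where "k \<in> A" "norm (z k) = Max ?N"
    by auto
  then have k: "k \<in> A" "\<And>j. j \<in> A \<Longrightarrow> norm (z j) \<le> norm (z k)"
    using A by auto
  define r where "r = norm (z k)"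
  define T where "T = (\<Sum>j\<in>A - {k}. norm (z j) powr p)"
  have norm_pow: "norm (z j powr of_real p) = norm (z j) powr p" for j
    by (simp add: norm_powr_real_powr')
  have "norm S \<le> (\<Sum>i\<in>A. norm (z i) powr p)"
    unfolding S_def norm_pow[symmetric] by (rule norm_sum)
  also have "\<dots> \<le> (\<Sum>i\<in>A. r powr p)"
    unfolding r_def using k p by (intro sum_mono powr_mono2) auto
  finally have S_le: "norm S \<le> real (card A) * r powr p"
    by simp
  have card: "1 \<le> real (card A)"
    using A False by (simp add: Suc_leI card_gt_0_iff)
  have S_diff: "S - z k powr of_real p = (\<Sum>j\<in>A - {k}. z j powr of_real p)"
    unfolding S_def using A k(1) by (simp add: sum.remove)
  \<comment> \<open>Both \<open>S\<close> and \<open>z k\<^sup>p\<close> have modulus at most \<open>card A * r\<^sup>p\<close>; the Lipschitz constant there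
      has order \<open>(r\<^sup>p)\<close> to the power \<open>1 / p - 1\<close>, which is the exponent \<open>1 - p\<close> of \<open>r\<close>.\<close>
  have "norm (S powr of_real (1 / p) - (z k powr of_real p) powr of_real (1 / p))
      \<le> 1 / p * (real (card A) * r powr p) powr (1 / p - 1) * norm (S - z k powr of_real p)"
  proof (rule norm_powr_diff_le_upper)
    show "norm (z k powr of_real p) \<le> real (card A) * r powr p"
      using mult_right_mono[OF card, of "r powr p"] by (simp add: norm_pow r_def)
    show "0 \<le> Im S"
      unfolding S_def Im_sum using p z by (intro sum_nonneg Im_powr_nonneg) auto
  qed (use p z k S_le in \<open>auto intro: Im_powr_nonneg\<close>)
  also have "\<dots> = C * r powr (1 - p) * norm (S - z k powr of_real p)"
    using p by (simp add: C_def powr_mult powr_powr right_diff_distrib)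
  also have "\<dots> \<le> C * r powr (1 - p) * T"
    unfolding S_diff T_def norm_pow[symmetric] using p
    by (intro mult_left_mono norm_sum) (simp add: C_def)
  finally have first: "norm (S powr of_real (1 / p) - z k) \<le> C * r powr (1 - p) * T"
    using powr_powr_inverse_upper[of p "z k"] p z k(1) by simp
  \<comment> \<open>The linear sum deviates from \<open>z k\<close> by no more: split \<open>|z j|\<close> into its powers \<open>1 - p\<close> and \<open>p\<close>.\<close>
  have "norm (\<Sum>j\<in>A - {k}. z j) \<le> (\<Sum>j\<in>A - {k}. r powr (1 - p) * norm (z j) powr p)"
  proof (intro order_trans[OF norm_sum] sum_mono)
    fix j assume j: "j \<in> A - {k}"
    have "norm (z j) = norm (z j) powr (1 - p) * norm (z j) powr p"
      using powr_add[of "norm (z j)" "1 - p" p] by simp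
    also have "\<dots> \<le> r powr (1 - p) * norm (z j) powr p"
      unfolding r_def using k j p by (intro mult_right_mono powr_mono2) auto
    finally show "norm (z j) \<le> r powr (1 - p) * norm (z j) powr p" .
  qed
  then have second: "norm (\<Sum>j\<in>A - {k}. z j) \<le> r powr (1 - p) * T"
    by (simp add: T_def sum_distrib_left)
  have "norm (S powr of_real (1 / p) - (\<Sum>i\<in>A. z i)) =
      norm ((S powr of_real (1 / p) - z k) - (\<Sum>j\<in>A - {k}. z j))"
    using A k(1) by (simp add: sum.remove algebra_simps)
  also have "\<dots> \<le> C * r powr (1 - p) * T + r powr (1 - p) * T"
    using norm_triangle_ineq4 first second by (rule order_trans[OF _ add_mono])
  also have "\<dots> = (C + 1) * (r powr (1 - p) * T)"
    by (simp add: algebra_simps)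
  also have "\<dots> \<le> (C + 1) * (\<Sum>i\<in>A. \<Sum>j\<in>A - {i}. norm (z i) powr (1 - p) * norm (z j) powr p)"
  proof (intro mult_left_mono)
    have "r powr (1 - p) * T = (\<Sum>j\<in>A - {k}. norm (z k) powr (1 - p) * norm (z j) powr p)"
      by (simp add: T_def r_def sum_distrib_left)
    also have "\<dots> \<le> (\<Sum>i\<in>A. \<Sum>j\<in>A - {i}. norm (z i) powr (1 - p) * norm (z j) powr p)"
      using A k(1)
      by (intro member_le_sum[where f = "\<lambda>i. \<Sum>j\<in>A - {i}. norm (z i) powr (1 - p) * norm (z j) powr p"])
        (auto intro!: sum_nonneg)
    finally show "r powr (1 - p) * T \<le> \<dots>" .
    show "0 \<le> C + 1"
      using p by (simp add: C_def)
  qed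
  finally show ?thesis
    by (simp add: S_def C_def)
qed simp

text \<open>The factor \<open>n^(1/p)\<close> cancels the normalisation of the mean inside the power \<open>1 / p\<close>.\<close>

lemma scaled_shifted_power_mean:
  assumes "1 \<le> n"
  shows "complex_of_real (real n powr (1 / p)) * shifted_power_mean \<alpha> p n x =
    (\<Sum>j=1..n. (complex_of_real (x j) + \<alpha>) powr of_real p) powr of_real (1 / p)
      - of_real (real n powr (1 / p)) * \<alpha>"
proof -
  let ?S = "\<Sum>j=1..n. (complex_of_real (x j) + \<alpha>) powr of_real p"
  have "?S powr of_real (1 / p) = (of_real (real n) * (1 / of_nat n * ?S)) powr of_real (1 / p)"
    using assms by simp
  also have "\<dots> = of_real (real n) powr of_real (1 / p) * (1 / of_nat n * ?S) powr of_real (1 / p)"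
    by (rule powr_times_real_left) auto
  also have "of_real (real n) powr of_real (1 / p) = complex_of_real (real n powr (1 / p))"
    by (rule powr_of_real) simp
  finally show ?thesis
    by (simp add: shifted_power_mean_def shifted_power_inv_def shifted_power_def right_diff_distrib)
qed

section \<open>Moments\<close>

context prob_space
begin

lemma in_L_mono:
  assumes Y: "in_L t Y" and st: "0 \<le> s" "s \<le> t"
  shows "in_L s Y"
proof -
  have Y_meas: "Y \<in> borel_measurable M"
    using Y by (simp add: in_L_def)
  have "norm y powr s \<le> 1 + norm y powr t" for y :: 'b
  proof (cases "norm y \<le> 1")
    case True
    then have "norm y powr s \<le> 1"
      using st by (intro powr_le1) auto
    then show ?thesis
      by (simp add: add_increasing2)
  next
    case False
    then have "norm y powr s \<le> norm y powr t"
      using st by (intro powr_mono) auto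
    then show ?thesis by simp
  qed
  then have "(\<integral>\<^sup>+ \<omega>. ennreal (norm (Y \<omega>) powr s) \<partial>M)
      \<le> (\<integral>\<^sup>+ \<omega>. 1 + ennreal (norm (Y \<omega>) powr t) \<partial>M)"
    by (intro nn_integral_mono)
      (simp add: ennreal_1[symmetric] ennreal_plus[symmetric] del: ennreal_1 ennreal_plus)
  also have "\<dots> = 1 + (\<integral>\<^sup>+ \<omega>. ennreal (norm (Y \<omega>) powr t) \<partial>M)"
    using Y_meas by (subst nn_integral_add) (auto simp: emeasure_space_1)
  also have "\<dots> < \<infinity>"
    using Y by (simp add: in_L_def)
  finally show ?thesis
    using Y_meas by (simp add: in_L_def)
qed

lemma in_L_of_real_add_const:
  fixes Y :: "'a \<Rightarrow> real" and c :: complex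
  assumes Y: "in_L s Y" and s: "0 \<le> s"
  shows "in_L s (\<lambda>\<omega>. complex_of_real (Y \<omega>) + c)"
proof -
  have Y_meas [measurable]: "Y \<in> borel_measurable M"
    using Y by (simp add: in_L_def)
  have bound: "norm (complex_of_real y + c) powr s \<le> 2 powr s * (norm y powr s + norm c powr s)" for y
  proof -
    have "norm (complex_of_real y + c) powr s \<le> (2 * max (norm y) (norm c)) powr s"
      using norm_triangle_ineq[of "complex_of_real y" c] s by (intro powr_mono2) auto
    also have "\<dots> = 2 powr s * max (norm y) (norm c) powr s"
      by (simp add: powr_mult)
    also have "\<dots> \<le> 2 powr s * (norm y powr s + norm c powr s)"
      by (intro mult_left_mono) (auto simp: max_def)
    finally show ?thesis .
  qed
  have "(\<integral>\<^sup>+ \<omega>. ennreal (norm (complex_of_real (Y \<omega>) + c) powr s) \<partial>M)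
      \<le> (\<integral>\<^sup>+ \<omega>. ennreal (2 powr s) * (ennreal (norm (Y \<omega>) powr s) + ennreal (norm c powr s)) \<partial>M)"
    using bound by (intro nn_integral_mono)
      (simp add: ennreal_plus[symmetric] ennreal_mult[symmetric] del: ennreal_plus)
  also have "\<dots> = ennreal (2 powr s) *
      ((\<integral>\<^sup>+ \<omega>. ennreal (norm (Y \<omega>) powr s) \<partial>M) + ennreal (norm c powr s))"
    by (simp add: nn_integral_cmult nn_integral_add emeasure_space_1)
  also have "\<dots> < \<infinity>"
    using Y by (simp add: in_L_def ennreal_mult_less_top)
  finally show ?thesis
    by (simp add: in_L_def)
qed

lemma in_L_identically_distributed:
  fixes Y Z :: "'a \<Rightarrow> 'b::real_normed_vector"
  assumes "in_L s Y" "distr M borel Z = distr M borel Y" "Z \<in> borel_measurable M"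
  shows "in_L s Z"
proof -
  have "(\<integral>\<^sup>+ \<omega>. ennreal (norm (Z \<omega>) powr s) \<partial>M) = (\<integral>\<^sup>+ y. ennreal (norm y powr s) \<partial>distr M borel Z)"
    using assms(3) by (subst nn_integral_distr) auto
  also have "\<dots> = (\<integral>\<^sup>+ \<omega>. ennreal (norm (Y \<omega>) powr s) \<partial>M)"
    unfolding assms(2) using assms(1) by (subst nn_integral_distr) (auto simp: in_L_def)
  finally show ?thesis
    using assms by (simp add: in_L_def)
qed

text \<open>
  For dependent factors, a Hoelder estimate would require moments of order \<open>s + t\<close>. Independence
  separates the two orders; this is what turns moments of order below \<open>1\<close> into integrability.
\<close>

lemma indep_vars_mixed_moment_finite:
  fixes Z :: "'i \<Rightarrow> 'a \<Rightarrow> 'b::real_normed_vector"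
  assumes indep: "indep_vars (\<lambda>_. borel) Z I" and ij: "i \<in> I" "j \<in> I" "i \<noteq> j"
    and L: "in_L s (Z i)" "in_L t (Z j)"
  shows "(\<integral>\<^sup>+ \<omega>. ennreal (norm (Z i \<omega>) powr s * norm (Z j \<omega>) powr t) \<partial>M) < \<infinity>"
proof -
  define g where "g k y = ennreal (norm (y::'b) powr (if k = i then s else t))" for k y
  have "indep_vars (\<lambda>_. borel) (\<lambda>k \<omega>. g k (Z k \<omega>)) {i, j}"
    using indep_vars_subset[OF indep, of "{i, j}"] ij
    by (rule_tac indep_vars_compose2) (auto simp: g_def)
  then have "(\<integral>\<^sup>+ \<omega>. (\<Prod>k\<in>{i, j}. g k (Z k \<omega>)) \<partial>M) = (\<Prod>k\<in>{i, j}. \<integral>\<^sup>+ \<omega>. g k (Z k \<omega>) \<partial>M)"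
    by (intro indep_vars_nn_integral) auto
  also have "\<dots> < \<infinity>"
    using ij L by (simp add: g_def in_L_def ennreal_mult_less_top)
  finally show ?thesis
    using ij by (simp add: g_def ennreal_mult)
qed

lemma in_L_1_of_pointwise_bound:
  fixes F :: "'a \<Rightarrow> complex"
  assumes "F \<in> borel_measurable M" "G \<in> borel_measurable M"
    and "\<And>\<omega>. norm (F \<omega>) \<le> C * G \<omega> + D" "\<And>\<omega>. 0 \<le> G \<omega>" "0 \<le> C" "0 \<le> D"
    and "(\<integral>\<^sup>+ \<omega>. ennreal (G \<omega>) \<partial>M) < \<infinity>"
  shows "in_L 1 F"
proof -
  have "(\<integral>\<^sup>+ \<omega>. ennreal (norm (F \<omega>) powr 1) \<partial>M) \<le> (\<integral>\<^sup>+ \<omega>. ennreal C * ennreal (G \<omega>) + ennreal D \<partial>M)"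
    using assms(3-6)
    by (intro nn_integral_mono)
      (simp add: ennreal_plus[symmetric] ennreal_mult[symmetric] del: ennreal_plus)
  also have "\<dots> = ennreal C * (\<integral>\<^sup>+ \<omega>. ennreal (G \<omega>) \<partial>M) + ennreal D"
    using assms(2) by (simp add: nn_integral_cmult nn_integral_add emeasure_space_1)
  also have "\<dots> < \<infinity>"
    using assms(7) by (simp add: ennreal_mult_less_top)
  finally show ?thesis
    using assms(1) by (simp add: in_L_def)
qed

end

section \<open>Integrability of the difference\<close>

theorem theorem5p2:
  fixes M :: "'a measure"
    and X :: "nat \<Rightarrow> 'a \<Rightarrow> real"
    and p :: real and n :: nat and \<alpha> :: complex
  assumes "prob_space M"
    and "prob_space.iid_from_1 M X"
    and "\<forall>j\<ge>1. prob_space.continuous_rv M (X j)"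
    and "0 < p" and "p < 1"
    and "1 \<le> n"
    and "prob_space.in_L M (max p (1 - p)) (X 1)"
    and "0 \<le> Im \<alpha>"
  shows "prob_space.in_L M 1 (\<lambda>\<omega>.
           complex_of_real (real n powr (1 / p)) * shifted_power_mean \<alpha> p n (\<lambda>j. X j \<omega>)
           - of_nat n * shifted_power_mean \<alpha> 1 n (\<lambda>j. X j \<omega>))"
proof -
  interpret prob_space M by fact
  define Z where "Z j \<omega> = complex_of_real (X j \<omega>) + \<alpha>" for j \<omega>
  define c where "c = (of_nat n - complex_of_real (real n powr (1 / p))) * \<alpha>"
  define F where "F \<omega> = (\<Sum>j=1..n. Z j \<omega> powr of_real p) powr of_real (1 / p) - (\<Sum>j=1..n. Z j \<omega>)" for \<omega>
  define G where "G \<omega> = (\<Sum>i=1..n. \<Sum>j\<in>{1..n} - {i}. norm (Z i \<omega>) powr (1 - p) * norm (Z j \<omega>) powr p)" for \<omega>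
  have indep: "indep_vars (\<lambda>_. borel) X {1..}"
    and ident: "\<And>j. 1 \<le> j \<Longrightarrow> distr M borel (X j) = distr M borel (X 1)"
    using assms(2) unfolding iid_from_1_def by blast+
  have X_meas: "X j \<in> borel_measurable M" if "1 \<le> j" for j
    using indep that by (auto simp: indep_vars_def)
  have Z_meas [measurable]: "Z j \<in> borel_measurable M" if "j \<in> {1..n}" for j
  proof -
    have [measurable]: "X j \<in> borel_measurable M"
      using that by (intro X_meas) simp
    show ?thesis
      unfolding Z_def by measurable
  qed
  have Z_indep: "indep_vars (\<lambda>_. borel) Z {1..}"
    unfolding Z_def using indep by (rule indep_vars_compose2) measurable
  have Z_L: "in_L s (Z j)" if "1 \<le> j" "0 \<le> s" "s \<le> max p (1 - p)" for s j
    unfolding Z_def using that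
    by (intro in_L_of_real_add_const in_L_mono[OF in_L_identically_distributed[OF assms(7)]]
      ident X_meas) auto
  have diff_eq: "complex_of_real (real n powr (1 / p)) * shifted_power_mean \<alpha> p n (\<lambda>j. X j \<omega>)
      - of_nat n * shifted_power_mean \<alpha> 1 n (\<lambda>j. X j \<omega>) = F \<omega> + c" for \<omega>
    unfolding scaled_shifted_power_mean[OF assms(6)] shifted_power_mean_1[OF assms(6)] F_def Z_def c_def
    using assms(6) by (simp add: sum.distrib algebra_simps)
  show ?thesis
    unfolding diff_eq
  proof (rule in_L_1_of_pointwise_bound)
    show "(\<lambda>\<omega>. F \<omega> + c) \<in> borel_measurable M"
      unfolding F_def powr_def by measurable
    show "G \<in> borel_measurable M"
      unfolding G_def by measurable
    show "0 \<le> G \<omega>" for \<omega>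
      unfolding G_def by (intro sum_nonneg) auto
    show "norm (F \<omega> + c) \<le> (1 / p * real (card {1..n}) powr (1 / p - 1) + 1) * G \<omega> + norm c" for \<omega>
      unfolding F_def G_def using assms(4,5,8)
      by (intro order_trans[OF norm_triangle_ineq] add_right_mono norm_power_mean_defect_le)
        (auto simp: Z_def)
    show "0 \<le> 1 / p * real (card {1..n}) powr (1 / p - 1) + 1"
      using assms(4) by simp
    have "(\<integral>\<^sup>+ \<omega>. ennreal (G \<omega>) \<partial>M) = (\<integral>\<^sup>+ \<omega>. (\<Sum>i=1..n. \<Sum>j\<in>{1..n} - {i}.
        ennreal (norm (Z i \<omega>) powr (1 - p) * norm (Z j \<omega>) powr p)) \<partial>M)"
      by (simp add: G_def sum_nonneg)
    also have "\<dots> = (\<Sum>i=1..n. \<integral>\<^sup>+ \<omega>. (\<Sum>j\<in>{1..n} - {i}.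
        ennreal (norm (Z i \<omega>) powr (1 - p) * norm (Z j \<omega>) powr p)) \<partial>M)"
      by (rule nn_integral_sum) measurable
    also have "\<dots> = (\<Sum>i=1..n. \<Sum>j\<in>{1..n} - {i}.
        \<integral>\<^sup>+ \<omega>. ennreal (norm (Z i \<omega>) powr (1 - p) * norm (Z j \<omega>) powr p) \<partial>M)"
      by (intro sum.cong refl nn_integral_sum) measurable
    also have "\<dots> < \<infinity>"
    proof -
      have "(\<integral>\<^sup>+ \<omega>. ennreal (norm (Z i \<omega>) powr (1 - p) * norm (Z j \<omega>) powr p) \<partial>M) < \<infinity>"
        if "i \<in> {1..n}" "j \<in> {1..n} - {i}" for i j
        using that assms(4,5) by (intro indep_vars_mixed_moment_finite[OF Z_indep] Z_L) auto
      then show ?thesis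
        by simp
    qed
    finally show "(\<integral>\<^sup>+ \<omega>. ennreal (G \<omega>) \<partial>M) < \<infinity>" .
  qed auto
qed

end
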